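(* Let $(X,\preceq)$ be a locally compact and connected Hausdorff topological lattice. Then the map $x\mapsto x^{\downarrow}$ topologically order-embeds $(X,\preceq)$ in $(\mathcal{C}(X),\subseteq)$, where $\mathcal{C}(X)$ is endowed with the Fell topology.
   Context: A Hausdorff topological lattice is a lattice $(X,\preceq)$ where $X$ carries a Hausdorff topology such that $(x,y)\mapsto x\wedge y$ and $(x,y)\mapsto x\vee y$ are continuous from $X\times X$ into $X$; it is locally compact (connected) if the space $X$ is. (Then $\preceq$ is closed in $X\times X$, so principal ideals are closed.) For $x\in X$, $x^{\downarrow}:=\{z\in X:z\preceq x\}$. $\mathcal{C}(X)$ is the set of all closed subsets of $X$ (including $\varnothing$), ordered by inclusion. The Fell topology on $\mathcal{C}(X)$ is generated (as a subbase) by all sets $\{A\in\mathcal{C}(X):A\cap O\neq\varnothing\}$ with $O\subseteq X$ open, and all sets $\{A\in\mathcal{C}(X):A\subseteq X\setminus K\}$ with $K\subseteq X$ compact. A map $\phi:(X_1,\preceq_1)\to(X_2,\preceq_2)$ topologically order-embeds if $x\preceq_1 y\iff\phi(x)\preceq_2\phi(y)$ for all $x,y\in X_1$ and $\phi$ is a homeomorphism from $X_1$ onto $\phi(X_1)$ with the subspace topology. *)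

theory Defs
  imports "HOL-Analysis.Analysis"
begin

definition Fell_topology :: "'a topology \<Rightarrow> 'a set topology" where
  "Fell_topology X =
     topology_generated_by
       ({{A. closedin X A \<and> A \<inter> U \<noteq> {}} | U. openin X U} \<union>
        {{A. closedin X A \<and> A \<subseteq> topspace X - K} | K. compactin X K})"

(* The underlying set consists of all closed sets, the empty set included (take K = {}). *)
lemma topspace_Fell_topology: "topspace (Fell_topology X) = {A. closedin X A}"
proof -
  have "{A. closedin X A} = {A. closedin X A \<and> A \<subseteq> topspace X - {}}"
    by (auto dest: closedin_subset)
  then have "{A. closedin X A} \<in> {{A. closedin X A \<and> A \<subseteq> topspace X - K} | K. compactin X K}"
    by blast
  then show ?thesis
    unfolding Fell_topology_def topology_generated_by_topspace by blast
qed

(* The orders are only inspected on the underlying sets of the two topologies. *)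
definition topologically_order_embeds ::
  "'a topology \<Rightarrow> ('a \<Rightarrow> 'a \<Rightarrow> bool) \<Rightarrow> 'b topology \<Rightarrow> ('b \<Rightarrow> 'b \<Rightarrow> bool) \<Rightarrow> ('a \<Rightarrow> 'b) \<Rightarrow> bool"
  where
  "topologically_order_embeds X le\<^sub>X Y le\<^sub>Y \<phi> \<longleftrightarrow>
     \<phi> \<in> topspace X \<rightarrow> topspace Y \<and>
     (\<forall>x\<in>topspace X. \<forall>y\<in>topspace X. le\<^sub>X x y \<longleftrightarrow> le\<^sub>Y (\<phi> x) (\<phi> y)) \<and>
     embedding_map X Y \<phi>"

end

theory Submission
  imports Defs
begin

text \<open>
  Continuity of \<open>x \<mapsto> {z. z \<le> x}\<close> is formal: the down-set of \<open>x\<close> meets \<open>U\<close> iff \<open>x\<close> lies in the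
  up-closure of \<open>U\<close>, which is open for open \<open>U\<close> because \<open>y \<mapsto> inf y u\<close> is continuous, and closed
  for compact \<open>U\<close> because the order is closed.

  The content is that a down-set which is Fell-close to that of \<open>x\<close> has its top element near \<open>x\<close>.
  Let \<open>V\<close> be an open neighbourhood of \<open>x\<close> with compact frontier; local compactness provides
  arbitrarily small ones. A principal down-set that meets a small
  neighbourhood \<open>W\<close> of \<open>x\<close> has a top element \<open>y\<close> above some \<open>w\<close> close to \<open>x\<close>. In a connected
  lattice the interval from \<open>w\<close> to \<open>y\<close> is connected, being the image of the whole space under a
  retraction \<open>z \<mapsto> sup (inf z y) w\<close>, so if \<open>y\<close> were outside \<open>V\<close> the interval would contain a point \<open>z\<close> of the frontier.
  Such a \<open>z\<close> is almost above \<open>x\<close>. As no frontier point equals \<open>x\<close>, frontier points below \<open>x\<close> are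
  not above \<open>x\<close>, and by compactness they stay uniformly away from being so: \<open>z\<close> must avoid a whole
  neighbourhood \<open>N\<close> of them. The rest of the frontier, outside \<open>N\<close>, is a compact set disjoint from
  the down-set of \<open>x\<close>, so a Fell-neighbourhood can also forbid \<open>z\<close> to lie there, whence \<open>y\<close>
  is in \<open>V\<close>.
\<close>

lemma continuous_on_inf_const:
  assumes "continuous_on UNIV (\<lambda>(x, y). inf x y :: 'a :: {inf, topological_space})"
  shows "continuous_on UNIV (\<lambda>x :: 'a. inf x u)"
proof -
  have "continuous_on UNIV (\<lambda>x :: 'a. (x, u))"
    by (intro continuous_intros)
  then show ?thesis
    using continuous_on_compose2[OF assms, of UNIV "\<lambda>x. (x, u)"] by simp
qed

lemma closed_le_if_continuous_inf:
  assumes "continuous_on UNIV (\<lambda>(x, y). inf x y :: 'a :: {lattice, t2_space})"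
  shows "closed {(x, y). x \<le> (y :: 'a)}"
proof -
  have "closed {p :: 'a \<times> 'a. (\<lambda>(x, y). inf x y) p = fst p}"
    by (intro closed_Collect_eq assms continuous_intros)
  moreover have "{p :: 'a \<times> 'a. (\<lambda>(x, y). inf x y) p = fst p} = {(x, y). x \<le> y}"
    by (auto simp: le_iff_inf)
  ultimately show ?thesis by simp
qed

lemma closed_down_set:
  assumes "closed {(x, y). x \<le> (y :: 'a :: {order, topological_space})}"
  shows "closed {z. z \<le> (x :: 'a)}"
proof -
  have "closed ((\<lambda>z. (z, x)) -` {(x, y). x \<le> y})"
    by (intro closed_vimage assms continuous_intros)
  then show ?thesis by (simp add: vimage_def)
qed

lemma open_up_closure:
  fixes U :: "'a :: {lattice, t2_space} set"
  assumes inf: "continuous_on UNIV (\<lambda>(x, y). inf x y :: 'a)" and "open U"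
  shows "open {x. \<exists>u\<in>U. u \<le> x}"
proof -
  have "open ((\<lambda>x. inf x u) -` U)" for u
  proof (intro open_vimage \<open>open U\<close>)
    show "continuous_on UNIV (\<lambda>x. inf x u)"
      by (rule continuous_on_inf_const[OF inf])
  qed
  then have "open (\<Union>u\<in>U. (\<lambda>x. inf x u) -` U)"
    by blast
  moreover have "(\<Union>u\<in>U. (\<lambda>x. inf x u) -` U) = {x. \<exists>u\<in>U. u \<le> x}"
  proof (intro equalityI subsetI)
    fix x assume "x \<in> (\<Union>u\<in>U. (\<lambda>x. inf x u) -` U)"
    then obtain u where "inf x u \<in> U" by blast
    then show "x \<in> {x. \<exists>u\<in>U. u \<le> x}"
      using inf_le1 by blast
  next
    fix x assume "x \<in> {x. \<exists>u\<in>U. u \<le> x}"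
    then obtain u where "u \<in> U" "inf x u = u"
      by (auto simp: inf_absorb2)
    then show "x \<in> (\<Union>u\<in>U. (\<lambda>x. inf x u) -` U)"
      by (intro UN_I[of u]) simp_all
  qed
  ultimately show ?thesis by simp
qed

text \<open>
  This is the tube lemma for the open complement of \<open>R\<close>. With the order as \<open>R\<close> and
  a point on either side, it says that being not below, or not above, a given point persists
  uniformly over a neighbourhood of a compact set.
\<close>

lemma closed_relation_separates_compact:
  fixes R :: "('a :: topological_space \<times> 'b :: topological_space) set"
  assumes "closed R" "compact K" "compact L" "K \<times> L \<inter> R = {}"
  obtains M N where "open M" "open N" "K \<subseteq> M" "L \<subseteq> N" "M \<times> N \<inter> R = {}"
proof -
  have "openin (prod_topology euclidean euclidean) (- R)"
    using \<open>closed R\<close> by (simp add: open_closed)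
  moreover have "compactin euclidean K" "compactin euclidean L"
    using assms(2,3) by simp_all
  moreover have "K \<times> L \<subseteq> - R"
    using assms(4) by auto
  ultimately obtain M N where "openin euclidean M" "openin euclidean N" "K \<subseteq> M" "L \<subseteq> N"
      "M \<times> N \<subseteq> - R"
    by (metis Wallace_theorem_prod_topology)
  then show ?thesis
    by (intro that[of M N]) auto
qed

lemma closed_up_closure_compact:
  fixes K :: "'a :: {order, topological_space} set"
  assumes closed: "closed {(x, y). x \<le> (y :: 'a)}" and "compact K"
  shows "closed {x. \<exists>k\<in>K. k \<le> x}"
proof -
  have "\<exists>W. open W \<and> x \<in> W \<and> W \<subseteq> - {x. \<exists>k\<in>K. k \<le> x}" if "x \<in> - {x. \<exists>k\<in>K. k \<le> x}" for x
  proof -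
    have "K \<times> {x} \<inter> {(x, y). x \<le> y} = {}"
      using that by auto
    then obtain N W where NW: "open W" "K \<subseteq> N" "{x} \<subseteq> W" "N \<times> W \<inter> {(x, y). x \<le> y} = {}"
      using closed_relation_separates_compact[OF closed \<open>compact K\<close> compact_sing] by metis
    then have "W \<subseteq> - {x. \<exists>k\<in>K. k \<le> x}" by blast
    with NW(1,3) show ?thesis by blast
  qed
  then have "open (- {x. \<exists>k\<in>K. k \<le> x})"
    by (subst open_subopen) blast
  then show ?thesis by (simp add: closed_def)
qed

lemma connected_interval:
  fixes a b :: "'a :: {lattice, t2_space}"
  assumes inf: "continuous_on UNIV (\<lambda>(x, y). inf x y :: 'a)"
    and sup: "continuous_on UNIV (\<lambda>(x, y). sup x y :: 'a)"
    and "connected (UNIV :: 'a set)" and "a \<le> b"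
  shows "connected {a..b}"
proof -
  have "continuous_on UNIV (\<lambda>z. (inf z b, a))"
    by (intro continuous_intros continuous_on_inf_const[OF inf])
  then have "continuous_on UNIV (\<lambda>z. sup (inf z b) a)"
    using continuous_on_compose2[OF sup, of UNIV "\<lambda>z. (inf z b, a)"] by auto
  then have "connected (range (\<lambda>z. sup (inf z b) a))"
    using assms(3) by (rule connected_continuous_image)
  moreover have "range (\<lambda>z. sup (inf z b) a) = {a..b}"
  proof
    show "range (\<lambda>z. sup (inf z b) a) \<subseteq> {a..b}"
      using \<open>a \<le> b\<close> by auto
    show "{a..b} \<subseteq> range (\<lambda>z. sup (inf z b) a)"
    proof
      fix z assume "z \<in> {a..b}"
      then have "z = sup (inf z b) a"
        by (simp add: inf_absorb1 sup_absorb1)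
      then show "z \<in> range (\<lambda>z. sup (inf z b) a)" by blast
    qed
  qed
  ultimately show ?thesis by simp
qed

lemma openin_Fell_hit:
  "openin X U \<Longrightarrow> openin (Fell_topology X) {A. closedin X A \<and> A \<inter> U \<noteq> {}}"
  unfolding Fell_topology_def by (rule topology_generated_by_Basis) blast

lemma openin_Fell_miss:
  "compactin X K \<Longrightarrow> openin (Fell_topology X) {A. closedin X A \<and> A \<subseteq> topspace X - K}"
  unfolding Fell_topology_def by (rule topology_generated_by_Basis) blast

lemma continuous_map_down_set_Fell:
  assumes inf: "continuous_on UNIV (\<lambda>(x, y). inf x y :: 'a :: {lattice, t2_space})"
  shows "continuous_map euclidean (Fell_topology euclidean) (\<lambda>x :: 'a. {z. z \<le> x})"
proof -
  note closed = closed_le_if_continuous_inf[OF inf]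
  let ?\<phi> = "\<lambda>x :: 'a. {z. z \<le> x}"
  have hit: "open (?\<phi> -` {A. closed A \<and> A \<inter> U \<noteq> {}})" if "open U" for U
  proof -
    have "?\<phi> -` {A. closed A \<and> A \<inter> U \<noteq> {}} = {x. \<exists>u\<in>U. u \<le> x}"
      using closed_down_set[OF closed] by auto
    with open_up_closure[OF inf that] show ?thesis by simp
  qed
  have miss: "open (?\<phi> -` {A. closed A \<and> A \<subseteq> UNIV - K})" if "compact K" for K
  proof -
    have "?\<phi> -` {A. closed A \<and> A \<subseteq> UNIV - K} = - {x. \<exists>k\<in>K. k \<le> x}"
      using closed_down_set[OF closed] by auto
    with closed_up_closure_compact[OF closed that] show ?thesis
      by (simp add: closed_def)
  qed
  show ?thesis
    unfolding Fell_topology_def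
  proof (rule continuous_on_generated_topo)
    show "openin euclidean (?\<phi> -` \<U> \<inter> topspace euclidean)"
      if "\<U> \<in> {{A. closedin euclidean A \<and> A \<inter> U \<noteq> {}} | U. openin euclidean U} \<union>
        {{A. closedin euclidean A \<and> A \<subseteq> topspace euclidean - K} | K. compactin euclidean K}" for \<U>
    proof -
      from that consider U where "open U" "\<U> = {A. closed A \<and> A \<inter> U \<noteq> {}}"
        | K where "compact K" "\<U> = {A. closed A \<and> A \<subseteq> UNIV - K}"
        by auto
      then have "open (?\<phi> -` \<U>)"
        by cases (simp_all only: hit miss)
      then show ?thesis by simp
    qed
    have "range ?\<phi> \<subseteq> topspace (Fell_topology euclidean)"
      using closed_down_set[OF closed] by (auto simp: topspace_Fell_topology)
    then show "?\<phi> ` topspace euclidean \<subseteq>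
      \<Union> ({{A. closedin euclidean A \<and> A \<inter> U \<noteq> {}} | U. openin euclidean U} \<union>
        {{A. closedin euclidean A \<and> A \<subseteq> topspace euclidean - K} | K. compactin euclidean K})"
      unfolding Fell_topology_def topology_generated_by_topspace by simp
  qed
qed

text \<open>
  Without connectedness \<open>y\<close> could escape every compact set while its down-set
  converges to that of \<open>x\<close>; a connected interval has to leave traces on the frontier of \<open>V\<close>.
\<close>

lemma down_set_Fell_neighbourhood:
  fixes x :: "'a :: {lattice, t2_space}"
  assumes inf: "continuous_on UNIV (\<lambda>(x, y). inf x y :: 'a)"
    and sup: "continuous_on UNIV (\<lambda>(x, y). sup x y :: 'a)"
    and conn: "connected (UNIV :: 'a set)"
    and V: "open V" "x \<in> V" "compact (frontier V)"
  obtains \<N> where "openin (Fell_topology euclidean) \<N>" "{z. z \<le> x} \<in> \<N>"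
    "\<And>y. {z. z \<le> y} \<in> \<N> \<Longrightarrow> y \<in> V"
proof -
  note closed = closed_le_if_continuous_inf[OF inf]
  have "x \<notin> frontier V"
    using V by (simp add: frontier_def interior_open)
  then have "{x} \<times> (frontier V \<inter> {z. z \<le> x}) \<inter> {(x, y). x \<le> y} = {}"
    by (auto dest: antisym)
  moreover have "compact (frontier V \<inter> {z. z \<le> x})"
    by (intro compact_Int_closed V closed_down_set closed)
  ultimately obtain W N where NW: "open W" "open N" "{x} \<subseteq> W" "frontier V \<inter> {z. z \<le> x} \<subseteq> N"
      "W \<times> N \<inter> {(x, y). x \<le> y} = {}"
    using closed_relation_separates_compact[OF closed compact_sing] by metis
  have "compact (frontier V - N)"
    using V(3) NW(2) by (rule compact_diff)
  \<comment> \<open>Hitting \<open>V\<close> as well as \<open>W\<close> gives the interval below \<open>y\<close> an end point inside \<open>V\<close>.\<close>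
  let ?hit = "{A :: 'a set. closedin euclidean A \<and> A \<inter> (W \<inter> V) \<noteq> {}}"
  let ?miss = "{A :: 'a set. closedin euclidean A \<and> A \<subseteq> topspace euclidean - (frontier V - N)}"
  show ?thesis
  proof (rule that[of "?hit \<inter> ?miss"])
    show "openin (Fell_topology euclidean) (?hit \<inter> ?miss)"
      using \<open>open W\<close> \<open>open V\<close> \<open>compact (frontier V - N)\<close>
      by (intro openin_Int openin_Fell_hit openin_Fell_miss) auto
    show "{z. z \<le> x} \<in> ?hit \<inter> ?miss"
      using closed_down_set[OF closed, of x] NW V by auto
  next
    fix y assume y: "{z. z \<le> y} \<in> ?hit \<inter> ?miss"
    then obtain w where w: "w \<in> W" "w \<in> V" "w \<le> y" by blast
    show "y \<in> V"
    proof (rule ccontr)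
      assume "y \<notin> V"
      then have "{w..y} \<inter> frontier V \<noteq> {}"
        using w by (intro connected_Int_frontier connected_interval[OF inf sup conn]) auto
      then obtain z where z: "w \<le> z" "z \<le> y" "z \<in> frontier V" by auto
      with y have "z \<in> N" by blast
      with NW(5) w(1) z(1) show False by blast
    qed
  qed
qed

lemma open_neighbourhood_compact_frontier:
  fixes U :: "'a :: t2_space set"
  assumes "locally_compact_space (euclidean :: 'a topology)" "open U" "x \<in> U"
  obtains V where "open V" "x \<in> V" "V \<subseteq> U" "compact (frontier V)"
proof -
  obtain C K where CK: "open C" "compact K" "x \<in> C" "C \<subseteq> K"
    using assms(1) unfolding locally_compact_space_def by simp metis
  have "closure (C \<inter> U) \<subseteq> K"
    using CK by (intro closure_minimal compact_imp_closed) auto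
  then have "frontier (C \<inter> U) \<subseteq> K"
    by (auto simp: frontier_def)
  then have "compact (frontier (C \<inter> U))"
    using compact_Int_closed[OF \<open>compact K\<close> frontier_closed[of "C \<inter> U"]]
    by (simp add: Int_absorb1)
  then show ?thesis
    using CK assms by (intro that[of "C \<inter> U"]) auto
qed

theorem theorem15:
  assumes "continuous_on UNIV (\<lambda>(x, y). inf x y :: 'a :: {lattice, t2_space})"
    and "continuous_on UNIV (\<lambda>(x, y). sup x y :: 'a)"
    and "locally_compact_space (euclidean :: 'a topology)"
    and "connected_space (euclidean :: 'a topology)"
  shows "topologically_order_embeds
           (euclidean :: 'a topology) (\<le>)
           (Fell_topology euclidean) (\<subseteq>)
           (\<lambda>x. {z. z \<le> x})"
proof -
  let ?\<phi> = "\<lambda>x :: 'a. {z. z \<le> x}"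
  let ?F = "Fell_topology (euclidean :: 'a topology)"
  have conn: "connected (UNIV :: 'a set)"
    using assms(4) connectedin_topspace[of "euclidean :: 'a topology"] by simp
  have cont: "continuous_map euclidean ?F ?\<phi>"
    by (rule continuous_map_down_set_Fell[OF assms(1)])
  have order: "x \<le> y \<longleftrightarrow> ?\<phi> x \<subseteq> ?\<phi> y" for x y
    by (auto intro: order_trans)
  have inj: "inj ?\<phi>"
    by (rule injI) (metis order antisym order_refl)
  have "open_map euclidean (subtopology ?F (range ?\<phi>)) ?\<phi>"
    unfolding open_map_def
  proof (intro allI impI)
    fix U :: "'a set" assume "openin euclidean U"
    show "openin (subtopology ?F (range ?\<phi>)) (?\<phi> ` U)"
    proof (subst openin_subopen, intro ballI)
      fix A assume "A \<in> ?\<phi> ` U"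
      then obtain x where x: "x \<in> U" "A = ?\<phi> x" by blast
      obtain V where V: "open V" "x \<in> V" "V \<subseteq> U" "compact (frontier V)"
        using open_neighbourhood_compact_frontier[OF assms(3)] \<open>openin euclidean U\<close> x(1)
        by (metis open_openin)
      obtain \<N> where \<N>: "openin ?F \<N>" "?\<phi> x \<in> \<N>" "\<And>y. ?\<phi> y \<in> \<N> \<Longrightarrow> y \<in> V"
        using down_set_Fell_neighbourhood[OF assms(1,2) conn V(1,2,4)] by metis
      have "openin (subtopology ?F (range ?\<phi>)) (\<N> \<inter> range ?\<phi>)"
        using \<N>(1) by (auto simp: openin_subtopology)
      moreover have "A \<in> \<N> \<inter> range ?\<phi>" "\<N> \<inter> range ?\<phi> \<subseteq> ?\<phi> ` U"
        using \<N>(2,3) x(2) V(3) by blast+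
      ultimately show "\<exists>T. openin (subtopology ?F (range ?\<phi>)) T \<and> A \<in> T \<and> T \<subseteq> ?\<phi> ` U"
        by blast
    qed
  qed
  moreover have "range ?\<phi> \<subseteq> topspace ?F"
    using cont by (auto simp: continuous_map_def)
  ultimately have "embedding_map euclidean ?F ?\<phi>"
    using cont inj unfolding embedding_map_def
    by (intro bijective_open_imp_homeomorphic_map)
      (auto simp: continuous_map_in_subtopology)
  then show ?thesis
    unfolding topologically_order_embeds_def
    by (intro conjI ballI order continuous_map_funspace[OF cont])
qed

end
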